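(* Let $\tilde{\xi}\sim \mathcal{L}(A,B)$ be a linear-normal uncertain random variable, where $A\sim \mathcal{N}(\mu_A,\sigma_A)$ and $B\sim \mathcal{N}(\mu_B,\sigma_B)$ are two independent normal random variables. Let $\tilde\xi_{\sup}(\alpha)$, $\tilde\xi_{\inf}(\alpha)$ and $\tilde\xi_{exp}$ be the random variables obtained from $\tilde\xi$ by the optimistic, pessimistic and expected value criteria, respectively. Then the following hold: (I) $\tilde\xi_{\sup}(\alpha)\sim \mathcal{N}\big(\alpha\mu_A+(1-\alpha)\mu_B,\ \sqrt{\alpha^2\sigma_A^2+(1-\alpha)^2\sigma_B^2}\big)$ for every $\alpha\in (0,1)$; (II) $\tilde\xi_{\inf}(\alpha)\sim \mathcal{N}\big((1-\alpha)\mu_A+\alpha\mu_B,\ \sqrt{(1-\alpha)^2\sigma_A^2+\alpha^2\sigma_B^2}\big)$ for every $\alpha\in (0,1)$; (III) $\tilde\xi_{exp}\sim \mathcal{N}\Big(\frac{\mu_A+\mu_B}{2},\ \frac{\sqrt{\sigma_A^2+\sigma_B^2}}{2}\Big)$.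
   Context: Notation: $\omega\sim\mathcal{N}(\mu,\sigma)$, with $\mu\in\mathbb{R}$ and $\sigma>0$, means that the real random variable $\omega$ is normal with mean $\mu$ and standard deviation $\sigma$ (the second parameter is the standard deviation, not the variance), i.e. its distribution function is $x\mapsto\frac12\big[1+\mathrm{erf}\big(\frac{x-\mu}{\sigma\sqrt2}\big)\big]$, where $\mathrm{erf}(z)=\frac{2}{\sqrt{\pi}}\int_0^z e^{-t^2}\,dt$. Uncertain variables. An uncertainty space is a triple $(\Gamma,L_u,\mathcal{M})$, where $L_u$ is a $\sigma$-algebra on a nonempty set $\Gamma$ and $\mathcal{M}:L_u\to[0,1]$ satisfies $\mathcal{M}\{\Gamma\}=1$, $\mathcal{M}\{E\}+\mathcal{M}\{E^c\}=1$ for every $E\in L_u$, and $\mathcal{M}\{\bigcup_{i=1}^\infty E_i\}\le\sum_{i=1}^\infty\mathcal{M}\{E_i\}$ for every countable sequence of events. An uncertain variable is a measurable function $\xi:\Gamma\to\mathbb{R}$; its uncertainty distribution is $\Phi_u(x)=\mathcal{M}\{\xi\le x\}$. It is linear, written $\xi\sim\mathcal{L}(a,b)$ with real $a<b$, if $\Phi_u(x)=0$ for $x\le a$, $\Phi_u(x)=\frac{x-a}{b-a}$ for $a\le x\le b$, and $\Phi_u(x)=1$ for $x\ge b$. The optimistic, pessimistic and expected values of an uncertain variable $\xi$ are $\xi_{\sup}(\alpha)=\sup\{r\mid\mathcal{M}\{\xi\ge r\}\ge\alpha\}$, $\xi_{\inf}(\alpha)=\inf\{r\mid\mathcal{M}\{\xi\le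 r\}\ge\alpha\}$ (for $\alpha\in(0,1)$) and $\xi_{exp}=\int_0^\infty\mathcal{M}\{\xi\ge r\}\,dr-\int_{-\infty}^0\mathcal{M}\{\xi\le r\}\,dr$. For $\xi\sim\mathcal{L}(a,b)$ these equal $\alpha a+(1-\alpha)b$, $(1-\alpha)a+\alpha b$ and $\frac{a+b}{2}$, respectively. Linear-normal uncertain random variables. An uncertain random variable is a function $\tilde\xi$ from an uncertainty space to the set of random variables such that $Pr\{\tilde\xi(\omega)\in S\}$ is a measurable function of $\omega$ for every Borel set $S\subseteq\mathbb{R}$. A linear-normal uncertain random variable $\tilde\xi\sim\mathcal{L}(A,B)$ is a linear uncertain variable whose parameters $A$ and $B$ are (independent) normal random variables instead of constants. Transformed random variables. For $\tilde\xi\sim\mathcal{L}(A,B)$, the random variables given by the optimistic, pessimistic and expected value criteria are obtained by substituting the random parameters $A,B$ for $a,b$ in the optimistic value $\xi_{\sup}(\alpha)=\alpha a+(1-\alpha)b$, the pessimistic value $\xi_{\inf}(\alpha)=(1-\alpha)a+\alpha b$ and the expected value $\xi_{exp}=\frac{a+b}{2}$ of a linear uncertain variable $\xi\sim\mathcal{L}(a,b)$: $\tilde\xi_{\sup}(\alpha)=\alpha A+(1-\alpha)B$ and $\tilde\xi_{\inf}(\alpha)=(1-\alpha)A+\alpha B$ for $\alpha\in(0,1)$, and $\tilde\xi_{exp}=\frac{A+B}{2}$. *)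

theory Defs
  imports "HOL-Probability.Probability"
begin

section \<open>Normal random variables\<close>

text \<open>The second parameter of \<open>normal_density\<close> is the standard deviation, not the variance.\<close>

definition normal_rv :: "'w measure \<Rightarrow> ('w \<Rightarrow> real) \<Rightarrow> real \<Rightarrow> real \<Rightarrow> bool" where
  "normal_rv P X \<mu> \<sigma> \<longleftrightarrow> 0 < \<sigma> \<and> distributed P lborel X (normal_density \<mu> \<sigma>)"

definition erf :: "real \<Rightarrow> real" where
  "erf z = 2 / sqrt pi * (LBINT t=0..z. exp (- t\<^sup>2))"

lemma exp_sq_integrable: "integrable lborel (\<lambda>t::real. exp (- t\<^sup>2))"
proof -
  have "integrable lborel (\<lambda>t. sqrt pi * normal_density 0 (1 / sqrt 2) t)"
    by (intro integrable_mult_right integrable_normal_density) simp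
  also have "(\<lambda>t. sqrt pi * normal_density 0 (1 / sqrt 2) t) = (\<lambda>t. exp (- t\<^sup>2))"
    by (rule ext) (simp add: normal_density_def power_divide)
  finally show ?thesis .
qed

lemma exp_sq_interval_integrable: "interval_lebesgue_integrable lborel u v (\<lambda>t::real. exp (- t\<^sup>2))"
  unfolding interval_lebesgue_integrable_def set_integrable_def
  using integrable_mult_indicator[OF _ exp_sq_integrable] by auto

lemma exp_sq_Ici: "(LBINT t=0..\<infinity>. exp (- t\<^sup>2)) = sqrt pi / 2"
proof -
  have "AE x in lborel. x \<noteq> (0::real)" by (rule AE_lborel_singleton)
  then have "(LINT t:{0<..}|lborel. exp (- t\<^sup>2)) = (LINT t:{0..}|lborel. exp (- (t::real)\<^sup>2))"
    unfolding set_lebesgue_integral_def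
    by (intro integral_cong_AE) (auto elim!: eventually_mono simp: indicator_def)
  also have "\<dots> = sqrt pi / 2"
    unfolding set_lebesgue_integral_def
    using has_bochner_integral_integral_eq[OF gaussian_moment_0] .
  finally show ?thesis
    by (simp add: interval_lebesgue_integral_def zero_ereal_def)
qed

lemma exp_sq_Iic: "(LINT t:{..z}|lborel. exp (- t\<^sup>2)) = sqrt pi / 2 * (1 + erf z)"
proof -
  have "AE x in lborel. x \<noteq> z" by (rule AE_lborel_singleton)
  then have "(LINT t:{..z}|lborel. exp (- t\<^sup>2)) = (LINT t:{..<z}|lborel. exp (- t\<^sup>2))"
    unfolding set_lebesgue_integral_def
    by (intro integral_cong_AE) (auto elim!: eventually_mono simp: indicator_def)
  also have "\<dots> = (LBINT t=-\<infinity>..z. exp (- t\<^sup>2))"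
    by (simp add: interval_lebesgue_integral_def)
  also have "\<dots> = (LBINT t=-\<infinity>..0. exp (- t\<^sup>2)) + (LBINT t=0..z. exp (- t\<^sup>2))"
    by (rule interval_integral_sum[symmetric]) (rule exp_sq_interval_integrable)
  also have "(LBINT t=-\<infinity>..0. exp (- t\<^sup>2)) = sqrt pi / 2"
    by (subst interval_integral_reflect) (simp add: exp_sq_Ici)
  finally show ?thesis
    by (simp add: erf_def field_simps)
qed

lemma normal_density_Iic:
  assumes "0 < \<sigma>"
  shows "measure (density lborel (normal_density \<mu> \<sigma>)) {..x} = (1 + erf ((x - \<mu>) / (\<sigma> * sqrt 2))) / 2"
proof -
  let ?c = "\<sigma> * sqrt 2"
  have c: "0 < ?c" using assms by simp
  have dens: "normal_density \<mu> \<sigma> (\<mu> + ?c * t) = exp (- t\<^sup>2) / (?c * sqrt pi)" for t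
    using assms by (simp add: normal_density_def power_mult_distrib real_sqrt_mult field_simps)
  have "measure (density lborel (normal_density \<mu> \<sigma>)) {..x}
      = (\<integral>y. indicator {..x} y * normal_density \<mu> \<sigma> y \<partial>lborel)"
  proof -
    have "integrable lborel (\<lambda>y. indicator {..x} y * normal_density \<mu> \<sigma> y)"
      using integrable_mult_indicator[OF _ integrable_normal_density[OF assms], of "{..x}"] by simp
    then have "(\<integral>\<^sup>+y. ennreal (indicator {..x} y * normal_density \<mu> \<sigma> y) \<partial>lborel)
        = ennreal (\<integral>y. indicator {..x} y * normal_density \<mu> \<sigma> y \<partial>lborel)"
      by (intro nn_integral_eq_integral) auto
    moreover have "emeasure (density lborel (normal_density \<mu> \<sigma>)) {..x}
        = (\<integral>\<^sup>+y. ennreal (indicator {..x} y * normal_density \<mu> \<sigma> y) \<partial>lborel)"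
      by (subst emeasure_density) (auto intro!: nn_integral_cong simp: indicator_def)
    ultimately show ?thesis
      by (simp add: measure_def enn2real_ennreal integral_nonneg_AE)
  qed
  also have "\<dots> = ?c * (\<integral>t. indicator {..x} (\<mu> + ?c * t) * normal_density \<mu> \<sigma> (\<mu> + ?c * t) \<partial>lborel)"
    using lborel_integral_real_affine[of ?c "\<lambda>y. indicator {..x} y * normal_density \<mu> \<sigma> y" \<mu>] c assms by simp
  also have "\<dots> = ?c * (\<integral>t. indicator {..(x - \<mu>) / ?c} t * exp (- t\<^sup>2) / (?c * sqrt pi) \<partial>lborel)"
  proof -
    have "indicator {..x} (\<mu> + ?c * t) = (indicator {..(x - \<mu>) / ?c} t :: real)" for t
      using c by (simp add: indicator_def pos_le_divide_eq algebra_simps)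
    then show ?thesis by (simp add: dens)
  qed
  also have "\<dots> = (LINT t:{..(x - \<mu>) / ?c}|lborel. exp (- t\<^sup>2)) / sqrt pi"
    using assms by (simp add: set_lebesgue_integral_def)
  finally show ?thesis
    by (simp add: exp_sq_Iic)
qed

lemma (in prob_space) normal_rv_iff_cdf:
  "normal_rv M X \<mu> \<sigma> \<longleftrightarrow> 0 < \<sigma> \<and> X \<in> borel_measurable M \<and>
     (\<forall>x. prob {w \<in> space M. X w \<le> x} = 1 / 2 * (1 + erf ((x - \<mu>) / (\<sigma> * sqrt 2))))"
proof (cases "0 < \<sigma> \<and> X \<in> borel_measurable M")
  case False
  then show ?thesis
    by (auto simp: normal_rv_def distributed_def)
next
  case True
  then have s: "0 < \<sigma>" and X[measurable]: "X \<in> borel_measurable M" by auto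
  let ?N = "density lborel (normal_density \<mu> \<sigma>)"
  interpret N: real_distribution ?N
    using prob_space_normal_density[OF s, of \<mu>]
    by (simp add: real_distribution_def real_distribution_axioms_def)
  have cdf_X: "cdf (distr M borel X) x = prob {w \<in> space M. X w \<le> x}" for x
    by (simp add: cdf_def measure_distr vimage_def Int_def conj_commute)
  have "normal_rv M X \<mu> \<sigma> \<longleftrightarrow> distr M borel X = ?N"
    using s by (simp add: normal_rv_def distributed_def cong: distr_cong)
  also have "\<dots> \<longleftrightarrow> cdf (distr M borel X) = cdf ?N"
    using cdf_unique[OF real_distribution_distr[OF X] N.real_distribution_axioms] by auto
  also have "\<dots> \<longleftrightarrow> (\<forall>x. prob {w \<in> space M. X w \<le> x} = (1 + erf ((x - \<mu>) / (\<sigma> * sqrt 2))) / 2)"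
    by (simp add: fun_eq_iff cdf_X cdf_def[of ?N] normal_density_Iic[OF s])
  finally show ?thesis using True by simp
qed


section \<open>Uncertain variables\<close>

text \<open>Only the measurable space underlying \<open>G\<close> matters; the set function \<open>M\<close> is not additive in
  general.\<close>

locale uncertainty_space =
  fixes G :: "'g measure" and M :: "'g set \<Rightarrow> real"
  assumes space_nonempty: "space G \<noteq> {}"
    and range: "E \<in> sets G \<Longrightarrow> M E \<in> {0..1}"
    and normality: "M (space G) = 1"
    and duality: "E \<in> sets G \<Longrightarrow> M E + M (space G - E) = 1"
    and subadditivity: "(\<And>i. F i \<in> sets G) \<Longrightarrow>
      ennreal (M (\<Union>i::nat. F i)) \<le> (\<Sum>i. ennreal (M (F i)))"

definition uncertainty_distribution ::
    "'g measure \<Rightarrow> ('g set \<Rightarrow> real) \<Rightarrow> ('g \<Rightarrow> real) \<Rightarrow> real \<Rightarrow> real" where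
  "uncertainty_distribution G M \<xi> x = M {g \<in> space G. \<xi> g \<le> x}"

definition linear_uncertain ::
    "'g measure \<Rightarrow> ('g set \<Rightarrow> real) \<Rightarrow> ('g \<Rightarrow> real) \<Rightarrow> real \<Rightarrow> real \<Rightarrow> bool" where
  "linear_uncertain G M \<xi> a b \<longleftrightarrow> a < b \<and> \<xi> \<in> borel_measurable G \<and>
     (\<forall>x. (x \<le> a \<longrightarrow> uncertainty_distribution G M \<xi> x = 0) \<and>
          (a \<le> x \<and> x \<le> b \<longrightarrow> uncertainty_distribution G M \<xi> x = (x - a) / (b - a)) \<and>
          (b \<le> x \<longrightarrow> uncertainty_distribution G M \<xi> x = 1))"

definition optimistic_value ::
    "'g measure \<Rightarrow> ('g set \<Rightarrow> real) \<Rightarrow> ('g \<Rightarrow> real) \<Rightarrow> real \<Rightarrow> real" where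
  "optimistic_value G M \<xi> \<alpha> = Sup {r. M {g \<in> space G. r \<le> \<xi> g} \<ge> \<alpha>}"

definition pessimistic_value ::
    "'g measure \<Rightarrow> ('g set \<Rightarrow> real) \<Rightarrow> ('g \<Rightarrow> real) \<Rightarrow> real \<Rightarrow> real" where
  "pessimistic_value G M \<xi> \<alpha> = Inf {r. M {g \<in> space G. \<xi> g \<le> r} \<ge> \<alpha>}"

definition expected_value ::
    "'g measure \<Rightarrow> ('g set \<Rightarrow> real) \<Rightarrow> ('g \<Rightarrow> real) \<Rightarrow> real" where
  "expected_value G M \<xi> =
     (LBINT r:{0..}. M {g \<in> space G. r \<le> \<xi> g}) - (LBINT r:{..0}. M {g \<in> space G. \<xi> g \<le> r})"

definition linear_sup :: "real \<Rightarrow> real \<Rightarrow> real \<Rightarrow> real" where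
  "linear_sup \<alpha> a b = \<alpha> * a + (1 - \<alpha>) * b"

definition linear_inf :: "real \<Rightarrow> real \<Rightarrow> real \<Rightarrow> real" where
  "linear_inf \<alpha> a b = (1 - \<alpha>) * a + \<alpha> * b"

definition linear_exp :: "real \<Rightarrow> real \<Rightarrow> real" where
  "linear_exp a b = (a + b) / 2"

context uncertainty_space
begin

lemma M_empty: "M {} = 0"
  using duality[of "space G"] normality by simp

lemma M_Un:
  assumes [measurable]: "A \<in> sets G" "B \<in> sets G"
  shows "M (A \<union> B) \<le> M A + M B"
proof -
  let ?F = "\<lambda>i::nat. if i = 0 then A else if i = 1 then B else {}"
  have "(\<Union>i. ?F i) = A \<union> B"
    by (auto split: if_splits)
  moreover have "(\<Sum>i. ennreal (M (?F i))) = (\<Sum>i\<in>{0, 1}. ennreal (M (?F i)))"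
    by (rule suminf_finite) (auto simp: M_empty)
  moreover have "ennreal (M (\<Union>i. ?F i)) \<le> (\<Sum>i. ennreal (M (?F i)))"
    by (rule subadditivity) auto
  ultimately have "ennreal (M (A \<union> B)) \<le> ennreal (M A) + ennreal (M B)"
    by simp
  then show ?thesis
    using range[of A] range[of B] by (simp flip: ennreal_plus)
qed

lemma M_mono:
  assumes "A \<subseteq> B" and A: "A \<in> sets G" and B: "B \<in> sets G"
  shows "M A \<le> M B"
proof -
  have "(space G - A) \<union> B = space G"
    using assms sets.sets_into_space[OF B] by auto
  then have "1 \<le> M (space G - A) + M B"
    using M_Un[of "space G - A" B] A B normality by auto
  then show ?thesis using duality[OF A] by simp
qed

lemma linear_le:
  assumes "linear_uncertain G M \<xi> a b"
  shows "M {g \<in> space G. \<xi> g \<le> x} = max 0 (min 1 ((x - a) / (b - a)))"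
proof -
  have ab: "a < b" using assms by (simp add: linear_uncertain_def)
  consider "x \<le> a" | "a \<le> x" "x \<le> b" | "b \<le> x" by linarith
  then show ?thesis
  proof cases
    case 1
    then have "(x - a) / (b - a) \<le> 0" using ab by (simp add: divide_le_0_iff)
    then show ?thesis
      using assms 1 by (simp add: linear_uncertain_def uncertainty_distribution_def)
  next
    case 2
    then have "0 \<le> (x - a) / (b - a)" "(x - a) / (b - a) \<le> 1" using ab by auto
    then show ?thesis
      using assms 2 by (simp add: linear_uncertain_def uncertainty_distribution_def)
  next
    case 3
    then have "1 \<le> (x - a) / (b - a)" using ab by simp
    then show ?thesis
      using assms 3 by (simp add: linear_uncertain_def uncertainty_distribution_def)
  qed
qed

lemma linear_ge:
  assumes lin: "linear_uncertain G M \<xi> a b"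
  shows "M {g \<in> space G. x \<le> \<xi> g} = 1 - max 0 (min 1 ((x - a) / (b - a)))"
proof -
  let ?\<Phi> = "\<lambda>x. max 0 (min 1 ((x - a) / (b - a)))"
  have ab: "a < b" and [measurable]: "\<xi> \<in> borel_measurable G"
    using lin by (auto simp: linear_uncertain_def)
  have "M {g \<in> space G. \<xi> g < x} \<le> ?\<Phi> x"
    unfolding linear_le[OF lin, symmetric] by (rule M_mono) auto
  moreover have "?\<Phi> x \<le> M {g \<in> space G. \<xi> g < x}"
  proof (rule field_le_epsilon)
    fix e :: real assume "0 < e"
    let ?s = "x - e * (b - a)"
    have "?s < x" using \<open>0 < e\<close> ab by simp
    then have "?\<Phi> ?s \<le> M {g \<in> space G. \<xi> g < x}"
      unfolding linear_le[OF lin, symmetric] by (intro M_mono) auto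
    moreover have "(?s - a) / (b - a) = (x - a) / (b - a) - e"
      using ab by (simp add: field_simps)
    ultimately show "?\<Phi> x \<le> M {g \<in> space G. \<xi> g < x} + e"
      using \<open>0 < e\<close> by linarith
  qed
  moreover have "space G - {g \<in> space G. \<xi> g < x} = {g \<in> space G. x \<le> \<xi> g}" by auto
  ultimately show ?thesis
    using duality[of "{g \<in> space G. \<xi> g < x}"] by simp
qed

lemma optimistic_value_linear:
  assumes lin: "linear_uncertain G M \<xi> a b" and \<alpha>: "\<alpha> \<in> {0<..<1}"
  shows "optimistic_value G M \<xi> \<alpha> = linear_sup \<alpha> a b"
proof -
  have ab: "a < b" using lin by (simp add: linear_uncertain_def)
  have "\<alpha> \<le> M {g \<in> space G. r \<le> \<xi> g} \<longleftrightarrow> (r - a) / (b - a) \<le> 1 - \<alpha>" for r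
    unfolding linear_ge[OF lin] using \<alpha> by (auto simp: max_def min_def)
  also have "\<dots> r \<longleftrightarrow> r \<le> linear_sup \<alpha> a b" for r
    using ab by (simp add: linear_sup_def field_simps)
  finally have "{r. M {g \<in> space G. r \<le> \<xi> g} \<ge> \<alpha>} = {..linear_sup \<alpha> a b}" by auto
  then show ?thesis by (simp add: optimistic_value_def)
qed

lemma pessimistic_value_linear:
  assumes lin: "linear_uncertain G M \<xi> a b" and \<alpha>: "\<alpha> \<in> {0<..<1}"
  shows "pessimistic_value G M \<xi> \<alpha> = linear_inf \<alpha> a b"
proof -
  have ab: "a < b" using lin by (simp add: linear_uncertain_def)
  have "\<alpha> \<le> M {g \<in> space G. \<xi> g \<le> r} \<longleftrightarrow> \<alpha> \<le> (r - a) / (b - a)" for r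
    unfolding linear_le[OF lin] using \<alpha> by (auto simp: max_def min_def)
  also have "\<dots> r \<longleftrightarrow> linear_inf \<alpha> a b \<le> r" for r
    using ab by (simp add: linear_inf_def field_simps)
  finally have "{r. M {g \<in> space G. \<xi> g \<le> r} \<ge> \<alpha>} = {linear_inf \<alpha> a b..}" by auto
  then show ?thesis by (simp add: pessimistic_value_def)
qed

lemma expected_value_linear:
  assumes lin: "linear_uncertain G M \<xi> a b"
  shows "expected_value G M \<xi> = linear_exp a b"
proof -
  let ?\<Phi> = "\<lambda>x. max 0 (min 1 ((x - a) / (b - a)))"
  define N where "N = max \<bar>a\<bar> \<bar>b\<bar>"
  have ab: "a < b" using lin by (simp add: linear_uncertain_def)
  have N: "0 \<le> N" "- N \<le> a" "b \<le> N" unfolding N_def by auto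
  have low: "?\<Phi> x = 0" if "x \<le> a" for x
    using that ab by (simp add: divide_le_0_iff)
  have mid: "?\<Phi> x = (x - a) / (b - a)" if "a \<le> x" "x \<le> b" for x
    using that ab by simp
  have high: "?\<Phi> x = 1" if "b \<le> x" for x
    using that ab by (simp add: max_def min_def field_simps)
  have cont: "continuous_on S ?\<Phi>" for S
    using ab by (intro continuous_intros) auto
  have int: "?\<Phi> integrable_on {u..v}" for u v
    by (rule integrable_continuous_real) (rule cont)
  have "(LBINT r:{0..}. M {g \<in> space G. r \<le> \<xi> g}) = (LBINT r:{0..N}. 1 - ?\<Phi> r)"
    unfolding linear_ge[OF lin] set_lebesgue_integral_def
    using N high by (intro Bochner_Integration.integral_cong) (auto simp: indicator_def)
  also have "\<dots> = integral {0..N} (\<lambda>r. 1 - ?\<Phi> r)"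
    by (intro set_borel_integral_eq_integral borel_integrable_atLeastAtMost')
       (intro continuous_on_diff continuous_on_const cont)
  also have "\<dots> = N - integral {0..N} ?\<Phi>"
    using N by (subst integral_diff) (auto simp: int)
  finally have 1: "(LBINT r:{0..}. M {g \<in> space G. r \<le> \<xi> g}) = N - integral {0..N} ?\<Phi>" .
  have "(LBINT r:{..0}. M {g \<in> space G. \<xi> g \<le> r}) = (LBINT r:{-N..0}. ?\<Phi> r)"
    unfolding linear_le[OF lin] set_lebesgue_integral_def
    using N low by (intro Bochner_Integration.integral_cong) (auto simp: indicator_def)
  also have "\<dots> = integral {-N..0} ?\<Phi>"
    by (intro set_borel_integral_eq_integral borel_integrable_atLeastAtMost' cont)
  finally have 2: "(LBINT r:{..0}. M {g \<in> space G. \<xi> g \<le> r}) = integral {-N..0} ?\<Phi>" .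
  have "integral {-N..0} ?\<Phi> + integral {0..N} ?\<Phi> = integral {-N..N} ?\<Phi>"
    using N by (intro Henstock_Kurzweil_Integration.integral_combine int) auto
  also have "\<dots> = integral {-N..a} ?\<Phi> + integral {a..N} ?\<Phi>"
    using N ab by (intro Henstock_Kurzweil_Integration.integral_combine[symmetric] int) auto
  also have "integral {a..N} ?\<Phi> = integral {a..b} ?\<Phi> + integral {b..N} ?\<Phi>"
    using N ab by (intro Henstock_Kurzweil_Integration.integral_combine[symmetric] int) auto
  also have "integral {-N..a} ?\<Phi> = integral {-N..a} (\<lambda>x. 0)"
    by (rule integral_cong) (use low in auto)
  also have "integral {b..N} ?\<Phi> = integral {b..N} (\<lambda>x. 1)"
    by (rule integral_cong) (use high in auto)
  also have "integral {a..b} ?\<Phi> = integral {a..b} (\<lambda>x. (x - a) / (b - a))"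
    by (rule integral_cong) (use mid in auto)
  also have "\<dots> = (b - a)\<^sup>2 / (2 * (b - a)) - (a - a)\<^sup>2 / (2 * (b - a))"
  proof (intro integral_unique fundamental_theorem_of_calculus)
    fix x assume "x \<in> {a..b}"
    have "((\<lambda>x. (x - a)\<^sup>2 / (2 * (b - a))) has_real_derivative 2 * (x - a) / (2 * (b - a))) (at x within {a..b})"
      using ab DERIV_cdivide[of "\<lambda>x. (x - a)\<^sup>2" "2 * (x - a)" x "{a..b}" "2 * (b - a)"]
      by (auto intro!: derivative_eq_intros)
    also have "2 * (x - a) / (2 * (b - a)) = (x - a) / (b - a)"
      by (rule mult_divide_mult_cancel_left) simp
    finally show "((\<lambda>x. (x - a)\<^sup>2 / (2 * (b - a))) has_vector_derivative (x - a) / (b - a)) (at x within {a..b})"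
      by (simp flip: has_real_derivative_iff_has_vector_derivative)
  qed (use ab in simp)
  also have "(b - a)\<^sup>2 / (2 * (b - a)) - (a - a)\<^sup>2 / (2 * (b - a)) = (b - a) / 2"
    using ab by (simp add: power2_eq_square divide_simps)
  finally have "integral {-N..0} ?\<Phi> + integral {0..N} ?\<Phi> = (b - a) / 2 + (N - b)"
    using N by simp
  then show ?thesis
    unfolding expected_value_def 1 2 linear_exp_def by (simp add: field_simps)
qed

end


section \<open>Linear-normal uncertain random variables\<close>

definition uncertain_random_variable :: "'w measure \<Rightarrow> 'g measure \<Rightarrow> ('g \<Rightarrow> 'w \<Rightarrow> real) \<Rightarrow> bool" where
  "uncertain_random_variable P G \<xi> \<longleftrightarrow>
     (\<forall>g\<in>space G. \<xi> g \<in> borel_measurable P) \<and>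
     (\<forall>S\<in>sets borel. (\<lambda>g. measure P {w \<in> space P. \<xi> g w \<in> S}) \<in> borel_measurable G)"

text \<open>Independent normal parameters satisfy \<open>A w < B w\<close> only on an event of probability strictly
  between 0 and 1, and linear uncertain variables are defined for \<open>a < b\<close> only. Hence linearity of
  the realised uncertain variable can be asked for only where \<open>A w < B w\<close>.\<close>

definition linear_normal_urv ::
    "'w measure \<Rightarrow> 'g measure \<Rightarrow> ('g set \<Rightarrow> real) \<Rightarrow> ('g \<Rightarrow> 'w \<Rightarrow> real) \<Rightarrow>
     ('w \<Rightarrow> real) \<Rightarrow> ('w \<Rightarrow> real) \<Rightarrow> bool" where
  "linear_normal_urv P G M \<xi> A B \<longleftrightarrow>
     uncertain_random_variable P G \<xi> \<and>
     (\<exists>\<mu> \<sigma>. normal_rv P A \<mu> \<sigma>) \<and> (\<exists>\<mu> \<sigma>. normal_rv P B \<mu> \<sigma>) \<and>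
     prob_space.indep_var P borel A borel B \<and>
     (AE w in P. A w < B w \<longrightarrow> linear_uncertain G M (\<lambda>g. \<xi> g w) (A w) (B w))"

text \<open>The transformed random variables: the random parameters are substituted into the optimistic,
  pessimistic and expected values of a linear uncertain variable, also where \<open>A w \<ge> B w\<close>.\<close>

definition sup_rv :: "('w \<Rightarrow> real) \<Rightarrow> ('w \<Rightarrow> real) \<Rightarrow> real \<Rightarrow> 'w \<Rightarrow> real" where
  "sup_rv A B \<alpha> = (\<lambda>w. linear_sup \<alpha> (A w) (B w))"

definition inf_rv :: "('w \<Rightarrow> real) \<Rightarrow> ('w \<Rightarrow> real) \<Rightarrow> real \<Rightarrow> 'w \<Rightarrow> real" where
  "inf_rv A B \<alpha> = (\<lambda>w. linear_inf \<alpha> (A w) (B w))"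

definition exp_rv :: "('w \<Rightarrow> real) \<Rightarrow> ('w \<Rightarrow> real) \<Rightarrow> 'w \<Rightarrow> real" where
  "exp_rv A B = (\<lambda>w. linear_exp (A w) (B w))"

lemma (in uncertainty_space) transformed_rv_pathwise:
  assumes "linear_normal_urv P G M \<xi> A B"
  shows "AE w in P. A w < B w \<longrightarrow>
    (\<forall>\<alpha>\<in>{0<..<1}. sup_rv A B \<alpha> w = optimistic_value G M (\<lambda>g. \<xi> g w) \<alpha> \<and>
                   inf_rv A B \<alpha> w = pessimistic_value G M (\<lambda>g. \<xi> g w) \<alpha>) \<and>
    exp_rv A B w = expected_value G M (\<lambda>g. \<xi> g w)"
proof -
  have "AE w in P. A w < B w \<longrightarrow> linear_uncertain G M (\<lambda>g. \<xi> g w) (A w) (B w)"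
    using assms by (simp add: linear_normal_urv_def)
  then show ?thesis
    by eventually_elim
      (auto simp: sup_rv_def inf_rv_def exp_rv_def optimistic_value_linear
        pessimistic_value_linear expected_value_linear)
qed

end

theory Submission
  imports Defs
begin

text \<open>Each transformed variable is a fixed linear combination \<open>s * A + t * B\<close>,
  with weights (\<alpha>, 1 - \<alpha>), (1 - \<alpha>, \<alpha>) or (1/2, 1/2), all nonzero.
  Scaling a normal variable by \<open>s\<close> multiplies its mean by \<open>s\<close> and its
  standard deviation by \<open>\<bar>s\<bar>\<close>, and keeps the two variables independent. For
  independent normal summands, means and variances add. \<open>normal_rv_linear_combination\<close>
  packages this once; the three claims are instances of it.\<close>

lemma (in prob_space) normal_rv_linear_combination:
  assumes X: "normal_rv M X \<mu> \<sigma>" and Y: "normal_rv M Y \<nu> \<tau>"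
    and indep: "indep_var borel X borel Y" and "s \<noteq> 0" "t \<noteq> 0"
  shows "normal_rv M (\<lambda>w. s * X w + t * Y w) (s * \<mu> + t * \<nu>) (sqrt (s\<^sup>2 * \<sigma>\<^sup>2 + t\<^sup>2 * \<tau>\<^sup>2))"
proof -
  have pos: "0 < \<sigma>" "0 < \<tau>"
    using X Y by (simp_all add: normal_rv_def)
  \<comment> \<open>A zero weight would give a constant, which has no density; hence
    \<open>s \<noteq> 0\<close>.\<close>
  have "distributed M lborel (\<lambda>w. s * X w) (normal_density (s * \<mu>) (\<bar>s\<bar> * \<sigma>))"
    using normal_density_affine[of X \<mu> \<sigma> s 0] X \<open>s \<noteq> 0\<close> by (simp add: normal_rv_def)
  moreover have "distributed M lborel (\<lambda>w. t * Y w) (normal_density (t * \<nu>) (\<bar>t\<bar> * \<tau>))"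
    using normal_density_affine[of Y \<nu> \<tau> t 0] Y \<open>t \<noteq> 0\<close> by (simp add: normal_rv_def)
  moreover have "indep_var borel (\<lambda>w. s * X w) borel (\<lambda>w. t * Y w)"
    using indep_var_compose[OF indep, of "(*) s" borel "(*) t" borel] by (simp add: comp_def)
  ultimately have "distributed M lborel (\<lambda>w. s * X w + t * Y w)
      (normal_density (s * \<mu> + t * \<nu>) (sqrt ((\<bar>s\<bar> * \<sigma>)\<^sup>2 + (\<bar>t\<bar> * \<tau>)\<^sup>2)))"
    using pos \<open>s \<noteq> 0\<close> \<open>t \<noteq> 0\<close> by (intro add_indep_normal) simp_all
  \<comment> \<open>\<open>normal_rv\<close> also demands a positive standard deviation.\<close>
  moreover have "0 < s\<^sup>2 * \<sigma>\<^sup>2 + t\<^sup>2 * \<tau>\<^sup>2"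
    using pos \<open>s \<noteq> 0\<close> by (intro add_pos_nonneg) simp_all
  ultimately show ?thesis
    by (simp add: normal_rv_def power_mult_distrib)
qed

theorem theorem5:
  fixes P :: "'w measure" and G :: "'g measure" and M :: "'g set \<Rightarrow> real"
    and \<xi> :: "'g \<Rightarrow> 'w \<Rightarrow> real" and A B :: "'w \<Rightarrow> real" and \<mu>A \<sigma>A \<mu>B \<sigma>B :: real
  assumes "prob_space P"
    and "uncertainty_space G M"
    and "linear_normal_urv P G M \<xi> A B"
    and "normal_rv P A \<mu>A \<sigma>A"
    and "normal_rv P B \<mu>B \<sigma>B"
    and "prob_space.indep_var P borel A borel B"
  shows "(\<forall>\<alpha>\<in>{0<..<1}. normal_rv P (sup_rv A B \<alpha>)
            (\<alpha> * \<mu>A + (1 - \<alpha>) * \<mu>B) (sqrt (\<alpha>\<^sup>2 * \<sigma>A\<^sup>2 + (1 - \<alpha>)\<^sup>2 * \<sigma>B\<^sup>2))) \<and>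
         (\<forall>\<alpha>\<in>{0<..<1}. normal_rv P (inf_rv A B \<alpha>)
            ((1 - \<alpha>) * \<mu>A + \<alpha> * \<mu>B) (sqrt ((1 - \<alpha>)\<^sup>2 * \<sigma>A\<^sup>2 + \<alpha>\<^sup>2 * \<sigma>B\<^sup>2))) \<and>
         normal_rv P (exp_rv A B) ((\<mu>A + \<mu>B) / 2) (sqrt (\<sigma>A\<^sup>2 + \<sigma>B\<^sup>2) / 2)"
proof -
  interpret prob_space P by fact
  note comb = normal_rv_linear_combination[OF assms(4-6)]
  have "normal_rv P (exp_rv A B) ((\<mu>A + \<mu>B) / 2) (sqrt (\<sigma>A\<^sup>2 + \<sigma>B\<^sup>2) / 2)"
  proof -
    \<comment> \<open>Equal weights 1/2 leave a common factor 1/4 in the variance, which comes out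
      of the root as 1/2.\<close>
    have "sqrt ((1/2)\<^sup>2 * \<sigma>A\<^sup>2 + (1/2)\<^sup>2 * \<sigma>B\<^sup>2) = sqrt ((\<sigma>A\<^sup>2 + \<sigma>B\<^sup>2) / 2\<^sup>2)"
      by (simp add: power_divide add_divide_distrib)
    also have "\<dots> = sqrt (\<sigma>A\<^sup>2 + \<sigma>B\<^sup>2) / 2"
      by (simp only: real_sqrt_divide real_sqrt_abs abs_numeral)
    finally show ?thesis
      using comb[of "1/2" "1/2"]
      by (simp only:) (simp add: exp_rv_def[abs_def] linear_exp_def add_divide_distrib)
  qed
  then show ?thesis
    \<comment> \<open>Since \<alpha> lies strictly between 0 and 1, both \<alpha> and 1 - \<alpha>
      are nonzero, as \<open>comb\<close> requires.\<close>
    using comb by (simp add: sup_rv_def[abs_def] inf_rv_def[abs_def] linear_sup_def linear_inf_def)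
qed

end
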